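(* Let $\widehat{\boldsymbol{\theta}}_n$ be an asymptotically normal estimator of the copula parameter $\boldsymbol{\theta}_C\in\boldsymbol{\Theta}_C\subset\mathbb{R}^D$, with asymptotic variance-covariance matrix $\mathbf{V}$, and let $$\widehat{\mathcal{D}}_{\Phi,n,M_n}=\frac{1}{M_n}\sum_{\ell=1}^{M_n}\left\{\frac{\prod_{i=1}^k c_i\big(\widetilde{\mathbf{U}}_i^{(\ell)};\widehat{\boldsymbol{\theta}}_n\big)}{c\big(\widetilde{\mathbf{U}}^{(\ell)};\widehat{\boldsymbol{\theta}}_n\big)}\,\Phi\left(\frac{c\big(\widetilde{\mathbf{U}}^{(\ell)};\widehat{\boldsymbol{\theta}}_n\big)}{\prod_{i=1}^k c_i\big(\widetilde{\mathbf{U}}_i^{(\ell)};\widehat{\boldsymbol{\theta}}_n\big)}\right)\right\},$$ where the user-chosen sample size $M_n$ is such that $$\left|\widehat{\mathcal{D}}_{\Phi,n,M_n}-\mathcal{D}_\Phi(\widehat{\boldsymbol{\theta}}_n)\right|=o_p\left(\frac{1}{\sqrt n}\right),\qquad n\to\infty.$$ If the mapping $$\boldsymbol{\Theta}_C\to\mathbb{R}:\ \boldsymbol{\theta}_C\mapsto\mathcal{D}_\Phi(\boldsymbol{\theta}_C)=\int_{[0,1]^q}f(\mathbf{u};\boldsymbol{\theta}_C)\,d\mathbf{u},\qquad f(\mathbf{u};\boldsymbol{\theta}_C)=\prod_{i=1}^k c_i(\mathbf{u}_i;\boldsymbol{\theta}_C)\,\Phi\left(\frac{c(\mathbf{u};\boldsymbol{\theta}_C)}{\prod_{i=1}^k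 c_i(\mathbf{u}_i;\boldsymbol{\theta}_C)}\right),$$ is Fréchet differentiable, then the estimator $\widehat{\mathcal{D}}_{\Phi,n,M_n}$ is asymptotically normal. Moreover, if the derivative can be moved into the integral, then $$\sqrt n\left(\widehat{\mathcal{D}}_{\Phi,n,M_n}-\mathcal{D}_\Phi(\boldsymbol{\theta}_C)\right)\xrightarrow{d}\mathcal{N}(0,\boldsymbol{\beta}^{\mathrm{T}}\mathbf{V}\boldsymbol{\beta}),\qquad n\to\infty,$$ where $\boldsymbol{\beta}^{\mathrm{T}}=(\beta_1,\dots,\beta_D)$ with $$\beta_i=\int_{[0,1]^q}\frac{\partial f}{\partial\theta_{C,i}}(\mathbf{u};\boldsymbol{\theta}_C)\,d\mathbf{u},$$ and $\theta_{C,i}$ denotes the $i$-th component of $\boldsymbol{\theta}_C$.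
   Context: Setting: $\mathbf{X}=(\mathbf{X}_1,\dots,\mathbf{X}_k)$ is a $q$-dimensional random vector with $\mathbf{X}_i=(X_{i1},\dots,X_{id_i})$, $q=d_1+\cdots+d_k$, and continuous univariate marginals. Its copula $C(\cdot;\boldsymbol{\theta}_C)$ belongs to a specified parametric family with copula densities $\{c(\cdot;\boldsymbol{\theta}_C):\boldsymbol{\theta}_C\in\boldsymbol{\Theta}_C\subset\mathbb{R}^D\}$, $D=\dim(\boldsymbol{\Theta}_C)$; $c_i(\cdot;\boldsymbol{\theta}_C)$ is the corresponding marginal copula density of $\mathbf{X}_i$, and $\mathbf{u}=(\mathbf{u}_1,\dots,\mathbf{u}_k)$ with $\mathbf{u}_i\in[0,1]^{d_i}$. The true parameter is also denoted $\boldsymbol{\theta}_C$. The function $\Phi:(0,\infty)\to\mathbb{R}$ is continuous and convex with $\Phi(1)=0$. $\widehat{\boldsymbol{\theta}}_n$ is an estimator of $\boldsymbol{\theta}_C$ based on a sample of size $n$ from $\mathbf{X}$; that it is asymptotically normal with asymptotic variance-covariance matrix $\mathbf{V}$ means $\sqrt n(\widehat{\boldsymbol{\theta}}_n-\boldsymbol{\theta}_C)\xrightarrow{d}\mathcal{N}(\mathbf{0},\mathbf{V})$. For each $n$, given $\widehat{\boldsymbol{\theta}}_n=\widetilde{\boldsymbol{\theta}}$, the vectors $\widetilde{\mathbf{U}}^{(\ell)}=(\widetilde{\mathbf{U}}_1^{(\ell)},\dots,\widetilde{\mathbf{U}}_k^{(\ell)})$, $\ell=1,\dots,M_n$, form an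 i.i.d. sample from the distribution $C(\cdot;\widetilde{\boldsymbol{\theta}})$. $\mathcal{D}_\Phi(\widehat{\boldsymbol{\theta}}_n)$ is the map $\mathcal{D}_\Phi(\cdot)$ evaluated at $\widehat{\boldsymbol{\theta}}_n$. "$\widehat{\mathcal{D}}_{\Phi,n,M_n}$ is asymptotically normal" means that $\sqrt n(\widehat{\mathcal{D}}_{\Phi,n,M_n}-\mathcal{D}_\Phi(\boldsymbol{\theta}_C))$ converges in distribution to a centered normal law (a normal law with variance $0$ being the point mass at $0$). "The derivative can be moved into the integral" means that the Fréchet (total) derivative of $\mathcal{D}_\Phi$ at $\boldsymbol{\theta}_C$ in any direction $\mathbf{h}\in\mathbb{R}^D$ equals $\int_{[0,1]^q}\sum_{i=1}^D h_i\frac{\partial f}{\partial\theta_{C,i}}(\mathbf{u};\boldsymbol{\theta}_C)\,d\mathbf{u}$. *)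

theory Defs
  imports "HOL-Probability.Probability"
begin

section \<open>Convergence in distribution and normal laws\<close>

definition conv_in_distr :: "(nat \<Rightarrow> 'b::topological_space measure) \<Rightarrow> 'b measure \<Rightarrow> bool" where
  "conv_in_distr \<mu> \<nu> \<longleftrightarrow>
     (\<forall>g :: 'b \<Rightarrow> real. continuous_on UNIV g \<and> bounded (range g) \<longrightarrow>
        (\<lambda>n. \<integral>x. g x \<partial>(\<mu> n)) \<longlonglongrightarrow> (\<integral>x. g x \<partial>\<nu>))"

text \<open>
  The centered normal law on the reals, given by its variance; the library's normal density
  does not cover variance 0.
\<close>

definition normal_law :: "real \<Rightarrow> real measure" where
  "normal_law v =
     (if v = 0 then return borel 0 else density lborel (\<lambda>x. ennreal (normal_density 0 (sqrt v) x)))"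

text \<open>
  The law of \<open>A *v Z\<close> for a standard normal vector \<open>Z\<close>.  Every covariance matrix, singular or
  not, has the form \<open>A ** transpose A\<close>, and the law depends on \<open>A\<close> only through that matrix.
\<close>

definition mv_normal :: "real^'p^'p \<Rightarrow> (real^'p) measure \<Rightarrow> bool" where
  "mv_normal V N \<longleftrightarrow>
     (\<exists>A :: real^'p^'p. V = A ** transpose A \<and>
        N = distr (\<Pi>\<^sub>M i\<in>(UNIV :: 'p set). std_normal_distribution) borel (\<lambda>z. A *v (\<chi> i. z i)))"

definition asymp_normal_est ::
  "'w measure \<Rightarrow> (nat \<Rightarrow> 'w \<Rightarrow> real^'p) \<Rightarrow> real^'p \<Rightarrow> real^'p^'p \<Rightarrow> bool" where
  "asymp_normal_est M T \<theta> V \<longleftrightarrow>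
     (\<exists>N. mv_normal V N \<and>
        conv_in_distr (\<lambda>n. distr M borel (\<lambda>\<omega>. sqrt (real n) *\<^sub>R (T n \<omega> - \<theta>))) N)"

definition little_o_p :: "'w measure \<Rightarrow> (nat \<Rightarrow> 'w \<Rightarrow> real) \<Rightarrow> (nat \<Rightarrow> real) \<Rightarrow> bool" where
  "little_o_p M Y r \<longleftrightarrow>
     (\<forall>\<epsilon>>0. (\<lambda>n. measure M {\<omega> \<in> space M. \<bar>Y n \<omega>\<bar> > \<epsilon> * r n}) \<longlonglongrightarrow> 0)"


section \<open>Copulas and their densities\<close>

text \<open>
  The component \<open>j\<close> of block \<open>i\<close> has index \<open>(i, j)\<close>, so a \<open>q\<close>-dimensional vector is a function on
  \<open>block_idx k d\<close>, which has \<open>d 1 + \<dots> + d k\<close> elements.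
\<close>

definition block_idx :: "nat \<Rightarrow> (nat \<Rightarrow> nat) \<Rightarrow> (nat \<times> nat) set" where
  "block_idx k d = (SIGMA i:{1..k}. {1..d i})"

definition block :: "(nat \<Rightarrow> nat) \<Rightarrow> nat \<Rightarrow> (nat \<times> nat \<Rightarrow> real) \<Rightarrow> (nat \<Rightarrow> real)" where
  "block d i u = (\<lambda>j\<in>{1..d i}. u (i, j))"

text \<open>Lebesgue measure on the unit cube with coordinates indexed by \<open>I\<close>.\<close>

definition unit_cube :: "'j set \<Rightarrow> ('j \<Rightarrow> real) measure" where
  "unit_cube I = (\<Pi>\<^sub>M j\<in>I. restrict_space lborel {0..1::real})"

definition is_copula :: "'j set \<Rightarrow> ('j \<Rightarrow> real) measure \<Rightarrow> bool" where
  "is_copula I C \<longleftrightarrow> prob_space C \<and> sets C = sets (unit_cube I) \<and>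
     (\<forall>j\<in>I. distr C borel (\<lambda>u. u j) = uniform_measure lborel {0..1})"

text \<open>
  Sklar's identity: the joint distribution function of the law \<open>H\<close> is the copula evaluated at the
  univariate marginal distribution functions.
\<close>

definition has_copula :: "'j set \<Rightarrow> ('j \<Rightarrow> real) measure \<Rightarrow> ('j \<Rightarrow> real) measure \<Rightarrow> bool" where
  "has_copula I H C \<longleftrightarrow>
     (\<forall>x. measure H {y \<in> space H. \<forall>j\<in>I. y j \<le> x j} =
          measure C {u \<in> space C. \<forall>j\<in>I. u j \<le> cdf (distr H borel (\<lambda>y. y j)) (x j)})"

definition copula_of :: "'j set \<Rightarrow> (('j \<Rightarrow> real) \<Rightarrow> real) \<Rightarrow> ('j \<Rightarrow> real) measure" where
  "copula_of I c = density (unit_cube I) (\<lambda>u. ennreal (c u))"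

definition copula_density :: "'j set \<Rightarrow> (('j \<Rightarrow> real) \<Rightarrow> real) \<Rightarrow> bool" where
  "copula_density I c \<longleftrightarrow>
     c \<in> borel_measurable (unit_cube I) \<and> (\<forall>u\<in>space (unit_cube I). 0 \<le> c u) \<and>
     is_copula I (copula_of I c)"

definition block_marginal_density ::
  "nat \<Rightarrow> (nat \<Rightarrow> nat) \<Rightarrow> ((nat \<times> nat \<Rightarrow> real) \<Rightarrow> real) \<Rightarrow> nat \<Rightarrow> ((nat \<Rightarrow> real) \<Rightarrow> real) \<Rightarrow> bool" where
  "block_marginal_density k d c i ci \<longleftrightarrow>
     ci \<in> borel_measurable (unit_cube {1..d i}) \<and> (\<forall>v\<in>space (unit_cube {1..d i}). 0 \<le> ci v) \<and>
     distributed (copula_of (block_idx k d) c) (unit_cube {1..d i}) (block d i) (\<lambda>v. ennreal (ci v))"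


section \<open>Samples\<close>

definition iid_sample :: "'w measure \<Rightarrow> 'b measure \<Rightarrow> (nat \<Rightarrow> 'w \<Rightarrow> 'b) \<Rightarrow> nat set \<Rightarrow> bool" where
  "iid_sample M H X L \<longleftrightarrow>
     prob_space.indep_vars M (\<lambda>_. H) X L \<and> (\<forall>l\<in>L. distr M H (X l) = H)"

text \<open>
  Given \<open>T\<close>, the \<open>U 1, \<dots>, U m\<close> are i.i.d. from \<open>K (T \<omega>)\<close>: the product measure is a version of the
  conditional law of \<open>(U 1, \<dots>, U m)\<close> given the sigma-algebra generated by \<open>T\<close>.
\<close>

definition cond_iid_sample ::
  "'w measure \<Rightarrow> ('w \<Rightarrow> 't::topological_space) \<Rightarrow> 'b measure \<Rightarrow> ('t \<Rightarrow> 'b measure) \<Rightarrow>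
     nat \<Rightarrow> (nat \<Rightarrow> 'w \<Rightarrow> 'b) \<Rightarrow> bool" where
  "cond_iid_sample M T S K m U \<longleftrightarrow>
     (\<forall>l\<in>{1..m}. U l \<in> measurable M S) \<and>
     (\<forall>B\<in>sets (\<Pi>\<^sub>M l\<in>{1..m}. S). AE \<omega> in M.
        real_cond_exp M (vimage_algebra (space M) T borel)
          (\<lambda>\<omega>'. indicator B (\<lambda>l\<in>{1..m}. U l \<omega>')) \<omega>
        = measure (\<Pi>\<^sub>M l\<in>{1..m}. K (T \<omega>)) B)"


section \<open>Phi-dependence\<close>

text \<open>
  Below \<open>c\<close> and \<open>cm i\<close> are the joint density and the density of block \<open>i\<close>, with the parameter as
  last argument.
\<close>

definition block_prod ::
  "nat \<Rightarrow> (nat \<Rightarrow> nat) \<Rightarrow> (nat \<Rightarrow> (nat \<Rightarrow> real) \<Rightarrow> 't \<Rightarrow> real) \<Rightarrow> (nat \<times> nat \<Rightarrow> real) \<Rightarrow> 't \<Rightarrow> real" where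
  "block_prod k d cm u \<theta> = (\<Prod>i=1..k. cm i (block d i u) \<theta>)"

text \<open>
  The argument of \<open>\<Phi>\<close> is 0 where the joint density vanishes.  There \<open>\<Phi> 0\<close> is whatever value
  the total function \<open>\<Phi>\<close> has, in particular the limit of \<open>\<Phi>\<close> at 0 from the right if one
  chooses so.  Where the product of the block densities vanishes, the integrand is 0.
\<close>

definition phi_integrand ::
  "nat \<Rightarrow> (nat \<Rightarrow> nat) \<Rightarrow> (real \<Rightarrow> real) \<Rightarrow> ((nat \<times> nat \<Rightarrow> real) \<Rightarrow> 't \<Rightarrow> real) \<Rightarrow>
     (nat \<Rightarrow> (nat \<Rightarrow> real) \<Rightarrow> 't \<Rightarrow> real) \<Rightarrow> (nat \<times> nat \<Rightarrow> real) \<Rightarrow> 't \<Rightarrow> real" where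
  "phi_integrand k d \<Phi> c cm u \<theta> =
     block_prod k d cm u \<theta> * \<Phi> (c u \<theta> / block_prod k d cm u \<theta>)"

definition phi_dependence ::
  "nat \<Rightarrow> (nat \<Rightarrow> nat) \<Rightarrow> (real \<Rightarrow> real) \<Rightarrow> ((nat \<times> nat \<Rightarrow> real) \<Rightarrow> 't \<Rightarrow> real) \<Rightarrow>
     (nat \<Rightarrow> (nat \<Rightarrow> real) \<Rightarrow> 't \<Rightarrow> real) \<Rightarrow> 't \<Rightarrow> real" where
  "phi_dependence k d \<Phi> c cm \<theta> =
     (\<integral>u. phi_integrand k d \<Phi> c cm u \<theta> \<partial>unit_cube (block_idx k d))"

definition phi_estimator ::
  "nat \<Rightarrow> (nat \<Rightarrow> nat) \<Rightarrow> (real \<Rightarrow> real) \<Rightarrow> ((nat \<times> nat \<Rightarrow> real) \<Rightarrow> 't \<Rightarrow> real) \<Rightarrow>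
     (nat \<Rightarrow> (nat \<Rightarrow> real) \<Rightarrow> 't \<Rightarrow> real) \<Rightarrow> nat \<Rightarrow> (nat \<Rightarrow> nat \<times> nat \<Rightarrow> real) \<Rightarrow> 't \<Rightarrow> real" where
  "phi_estimator k d \<Phi> c cm m U \<theta> =
     (1 / real m) * (\<Sum>l=1..m. (block_prod k d cm (U l) \<theta> / c (U l) \<theta>) *
                              \<Phi> (c (U l) \<theta> / block_prod k d cm (U l) \<theta>))"


section \<open>Differentiation with respect to the parameter\<close>

text \<open>
  Functions of the parameter are only meaningful on the parameter space \<open>\<Theta>\<close>, so derivatives are
  taken within \<open>\<Theta>\<close>.  At interior points of \<open>\<Theta>\<close> these are the ordinary derivatives.
\<close>

definition axis_slice :: "(real^'p) set \<Rightarrow> real^'p \<Rightarrow> 'p \<Rightarrow> real set" where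
  "axis_slice \<Theta> \<theta> i = {t. \<theta> + t *\<^sub>R axis i 1 \<in> \<Theta>}"

definition partial_deriv :: "(real^'p) set \<Rightarrow> (real^'p \<Rightarrow> real) \<Rightarrow> real^'p \<Rightarrow> 'p \<Rightarrow> real" where
  "partial_deriv \<Theta> g \<theta> i =
     vector_derivative (\<lambda>t. g (\<theta> + t *\<^sub>R axis i 1)) (at 0 within axis_slice \<Theta> \<theta> i)"

definition deriv_into_integral ::
  "(real^'p) set \<Rightarrow> 'u measure \<Rightarrow> ('u \<Rightarrow> real^'p \<Rightarrow> real) \<Rightarrow> real^'p \<Rightarrow> bool" where
  "deriv_into_integral \<Theta> \<mu> f \<theta> \<longleftrightarrow>
     (\<forall>i. AE u in \<mu>. (\<lambda>t. f u (\<theta> + t *\<^sub>R axis i 1)) differentiable (at 0 within axis_slice \<Theta> \<theta> i)) \<and>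
     (\<forall>i. integrable \<mu> (\<lambda>u. partial_deriv \<Theta> (f u) \<theta> i)) \<and>
     (\<forall>h. frechet_derivative (\<lambda>\<eta>. \<integral>u. f u \<eta> \<partial>\<mu>) (at \<theta> within \<Theta>) h =
          (\<integral>u. (\<Sum>i\<in>UNIV. h $ i * partial_deriv \<Theta> (f u) \<theta> i) \<partial>\<mu>))"

end

theory Submission
  imports Defs
begin

text \<open>
  This is the delta method with a vanishing simulation error.  Write \<open>\<D>\<close> for the Phi-dependence
  as a function of the parameter, let \<open>b\<close> be its gradient at \<open>\<theta>\<^sub>C\<close> relative to \<open>\<Theta>\<close>, and let
  \<open>S n = sqrt n *\<^sub>R (\<theta>hat n - \<theta>\<^sub>C)\<close>.  Then

  \<open>sqrt n * (Dhat n - \<D> \<theta>\<^sub>C) = b \<bullet> S n + sqrt n * (Dhat n - \<D> (\<theta>hat n)) + sqrt n * R n\<close>,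

  where \<open>R n = \<D> (\<theta>hat n) - \<D> \<theta>\<^sub>C - b \<bullet> (\<theta>hat n - \<theta>\<^sub>C)\<close> is the linearisation error.  The second
  summand tends to 0 in probability by the choice of the simulation size.  So does the third: \<open>S n\<close>
  is tight because it converges in distribution (\<open>conv_in_distr_tight\<close>), so \<open>\<theta>hat n\<close> is within
  order \<open>1 / sqrt n\<close> of \<open>\<theta>\<^sub>C\<close>, where \<open>R n\<close> is small compared with that distance
  (\<open>linearisation_error_little_o_p\<close>).

  The limit is identified by characteristic functions.  Negligible summands do not change the limit
  of a characteristic function (\<open>char_distr_diff_tendsto_0\<close>), and that of \<open>b \<bullet> S n\<close> converges to
  that of \<open>b \<bullet> Z\<close> for \<open>Z\<close> normal with covariance matrix \<open>V\<close>
  (\<open>conv_in_distr_imp_char_inner\<close>), which is normal with variance \<open>b \<bullet> (V *v b)\<close>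
  (\<open>char_mv_normal_inner\<close>).  Levy's continuity theorem then gives weak convergence
  (\<open>delta_method\<close>), and characteristic functions treat the degenerate case of variance 0 in the
  same way as the others.  If the derivative can be moved into the integral, evaluating it along the
  coordinate axes yields \<open>b = \<beta>\<close>.
\<close>


section \<open>Convergence in distribution and characteristic functions\<close>

text \<open>
  The continuous cutoffs \<open>g j\<close> lie between the indicators of \<open>norm x > j + 1\<close> and \<open>norm x > j\<close>.
  Their integrals against the limit law vanish as \<open>j\<close> grows, and convergence in distribution
  transfers the smallness for one fixed \<open>j\<close> to almost all laws of the sequence.
\<close>

lemma conv_in_distr_tight:
  fixes \<mu> :: "nat \<Rightarrow> 'b::euclidean_space measure"
  assumes conv: "conv_in_distr \<mu> \<nu>" and \<nu>: "prob_space \<nu>" "sets \<nu> = sets borel"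
    and \<mu>: "\<And>n. prob_space (\<mu> n)" "\<And>n. sets (\<mu> n) = sets borel"
    and "0 < e"
  obtains K where "0 < K" "\<forall>\<^sub>F n in sequentially. measure (\<mu> n) {x. K < norm x} < e"
proof -
  define g :: "nat \<Rightarrow> 'b \<Rightarrow> real" where "g j x = min 1 (max 0 (norm x - real j))" for j x
  have g_cont: "continuous_on UNIV (g j)" for j
    unfolding g_def by (intro continuous_intros)
  have g_bd: "0 \<le> g j x" "g j x \<le> 1" for j x
    by (auto simp: g_def)
  have g_meas [measurable]: "g j \<in> borel_measurable borel" for j
    by (intro borel_measurable_continuous_onI g_cont)
  have g_meas': "g j \<in> borel_measurable \<nu>" "g j \<in> borel_measurable (\<mu> n)" for j n
    using g_meas[of j] by (simp_all add: measurable_cong_sets[OF \<nu>(2) refl] measurable_cong_sets[OF \<mu>(2) refl])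
  interpret \<nu>: prob_space \<nu> by fact
  have "(\<lambda>j. \<integral>x. g j x \<partial>\<nu>) \<longlonglongrightarrow> (\<integral>x. 0 \<partial>\<nu>)"
  proof (rule integral_dominated_convergence[where w = "\<lambda>_. 1"])
    have "(\<lambda>j. g j x) \<longlonglongrightarrow> 0" for x
    proof (rule tendsto_eventually)
      obtain j0 where "norm x \<le> real j0"
        using real_arch_simple by blast
      then show "\<forall>\<^sub>F j in sequentially. g j x = 0"
        unfolding eventually_sequentially g_def by (intro exI[of _ j0]) auto
    qed
    then show "AE x in \<nu>. (\<lambda>j. g j x) \<longlonglongrightarrow> 0" by simp
  qed (use g_meas' g_bd in auto)
  then have "\<forall>\<^sub>F j in sequentially. (\<integral>x. g j x \<partial>\<nu>) < e"
    using \<open>0 < e\<close> by (intro order_tendstoD) auto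
  then obtain j where j: "(\<integral>x. g j x \<partial>\<nu>) < e"
    unfolding eventually_sequentially by blast
  have "bounded (range (g j))"
    using g_bd by (intro boundedI[of _ 1]) auto
  with conv g_cont have "(\<lambda>n. \<integral>x. g j x \<partial>\<mu> n) \<longlonglongrightarrow> (\<integral>x. g j x \<partial>\<nu>)"
    unfolding conv_in_distr_def by blast
  then have "\<forall>\<^sub>F n in sequentially. (\<integral>x. g j x \<partial>\<mu> n) < e"
    using j by (rule order_tendstoD)
  moreover have "measure (\<mu> n) {x. real j + 1 < norm x} \<le> (\<integral>x. g j x \<partial>\<mu> n)" for n
  proof -
    interpret \<mu>: prob_space "\<mu> n" by fact
    let ?A = "{x :: 'b. real j + 1 < norm x}"
    have A: "?A \<in> sets (\<mu> n)"
      unfolding \<mu>(2) by measurable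
    have "measure (\<mu> n) ?A = (\<integral>x. indicator ?A x \<partial>\<mu> n)"
      using A by simp
    also have "\<dots> \<le> (\<integral>x. g j x \<partial>\<mu> n)"
    proof (rule integral_mono)
      show "integrable (\<mu> n) (indicator ?A :: _ \<Rightarrow> real)"
        using A by (intro integrable_real_indicator) (auto simp: \<mu>.emeasure_eq_measure)
      show "integrable (\<mu> n) (g j)"
        using g_meas' g_bd by (intro \<mu>.integrable_const_bound[of _ 1]) auto
    qed (auto simp: g_def indicator_def)
    finally show ?thesis .
  qed
  ultimately have "\<forall>\<^sub>F n in sequentially. measure (\<mu> n) {x. real j + 1 < norm x} < e"
    by (auto elim!: eventually_mono intro: le_less_trans)
  then show thesis
    by (intro that[of "real j + 1"]) auto
qed

text \<open>
  The real and imaginary parts of \<open>x \<mapsto> exp (i t (b \<bullet> x))\<close> are bounded continuous test functions.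
\<close>

lemma conv_in_distr_imp_char_inner:
  fixes \<mu> :: "nat \<Rightarrow> 'b::euclidean_space measure"
  assumes conv: "conv_in_distr \<mu> \<nu>" and \<nu>: "prob_space \<nu>" "sets \<nu> = sets borel"
    and \<mu>: "\<And>n. prob_space (\<mu> n)" "\<And>n. sets (\<mu> n) = sets borel"
  shows "(\<lambda>n. char (distr (\<mu> n) borel ((\<bullet>) b)) t) \<longlonglongrightarrow> char (distr \<nu> borel ((\<bullet>) b)) t"
proof -
  have eq: "char (distr \<rho> borel ((\<bullet>) b)) t =
      Complex (\<integral>x. cos (t * (b \<bullet> x)) \<partial>\<rho>) (\<integral>x. sin (t * (b \<bullet> x)) \<partial>\<rho>)"
    if "prob_space \<rho>" "sets \<rho> = sets borel" for \<rho> :: "'b measure"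
  proof -
    interpret \<rho>: prob_space \<rho> by fact
    have m: "f \<in> borel_measurable \<rho> \<longleftrightarrow> f \<in> borel_measurable borel" for f :: "'b \<Rightarrow> 'c::topological_space"
      by (simp add: measurable_cong_sets[OF that(2) refl])
    have "char (distr \<rho> borel ((\<bullet>) b)) t = (\<integral>x. iexp (t * (b \<bullet> x)) \<partial>\<rho>)"
      unfolding char_def by (subst integral_distr) (auto simp: m)
    moreover have "integrable \<rho> (\<lambda>x. iexp (t * (b \<bullet> x)))"
      by (rule \<rho>.integrable_iexp) (auto simp: m)
    ultimately show ?thesis
      by (auto simp: complex_eq_iff Re_exp Im_exp simp flip: integral_Re integral_Im)
  qed
  have "(\<lambda>n. \<integral>x. cos (t * (b \<bullet> x)) \<partial>\<mu> n) \<longlonglongrightarrow> (\<integral>x. cos (t * (b \<bullet> x)) \<partial>\<nu>)"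
    "(\<lambda>n. \<integral>x. sin (t * (b \<bullet> x)) \<partial>\<mu> n) \<longlonglongrightarrow> (\<integral>x. sin (t * (b \<bullet> x)) \<partial>\<nu>)"
    by (intro conv[unfolded conv_in_distr_def, rule_format];
        auto intro!: continuous_intros boundedI[of _ 1])+
  then show ?thesis
    by (auto simp: eq \<nu> \<mu> intro: tendsto_Complex)
qed

text \<open>
  The map \<open>x \<mapsto> exp (i t x)\<close> is bounded and Lipschitz, so variables that come close in probability
  have the same limit of characteristic functions.
\<close>

lemma char_distr_diff_tendsto_0:
  assumes M: "prob_space M"
    and X: "\<And>n. X n \<in> borel_measurable M" and Y: "\<And>n. Y n \<in> borel_measurable M"
    and close: "little_o_p M (\<lambda>n \<omega>. X n \<omega> - Y n \<omega>) (\<lambda>_. 1)"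
  shows "(\<lambda>n. char (distr M borel (X n)) t - char (distr M borel (Y n)) t) \<longlonglongrightarrow> 0"
proof (rule tendstoI)
  fix e :: real assume "0 < e"
  interpret prob_space M by fact
  define \<epsilon> where "\<epsilon> = e / (2 * (\<bar>t\<bar> + 1))"
  have \<epsilon>: "0 < \<epsilon>" "\<bar>t\<bar> * \<epsilon> \<le> e / 2"
    using \<open>0 < e\<close> by (auto simp: \<epsilon>_def field_simps)
  define A where "A n = {\<omega> \<in> space M. \<bar>X n \<omega> - Y n \<omega>\<bar> > \<epsilon>}" for n
  have A [measurable]: "A n \<in> sets M" for n
    unfolding A_def using X[of n] Y[of n] by measurable
  have bound: "norm (char (distr M borel (X n)) t - char (distr M borel (Y n)) t)
      \<le> e / 2 + 2 * prob (A n)" for n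
  proof -
    note [measurable] = X[of n] Y[of n]
    have int: "integrable M (\<lambda>\<omega>. iexp (t * X n \<omega>))" "integrable M (\<lambda>\<omega>. iexp (t * Y n \<omega>))"
      by (auto intro!: integrable_iexp)
    have pw: "cmod (iexp (t * X n \<omega>) - iexp (t * Y n \<omega>)) \<le> e / 2 + 2 * indicator (A n) \<omega>"
      if "\<omega> \<in> space M" for \<omega>
    proof (cases "\<omega> \<in> A n")
      case True
      have "cmod (iexp (t * X n \<omega>) - iexp (t * Y n \<omega>)) \<le> 1 + 1"
        by (rule order_trans[OF norm_triangle_ineq4]) simp
      with True \<open>0 < e\<close> show ?thesis by simp
    next
      case False
      then have "\<bar>X n \<omega> - Y n \<omega>\<bar> \<le> \<epsilon>" using that by (auto simp: A_def)
      have "iexp (t * X n \<omega>) - iexp (t * Y n \<omega>) =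
          iexp (t * Y n \<omega>) * (iexp (t * (X n \<omega> - Y n \<omega>)) - 1)"
        by (simp add: algebra_simps flip: exp_add)
      then have "cmod (iexp (t * X n \<omega>) - iexp (t * Y n \<omega>)) = cmod (iexp (t * (X n \<omega> - Y n \<omega>)) - 1)"
        by (simp add: norm_mult)
      also have "\<dots> \<le> \<bar>t * (X n \<omega> - Y n \<omega>)\<bar>"
        using iexp_approx1[of "t * (X n \<omega> - Y n \<omega>)" 0] by simp
      also have "\<dots> \<le> \<bar>t\<bar> * \<epsilon>"
        unfolding abs_mult by (intro mult_left_mono) (use \<open>\<bar>X n \<omega> - Y n \<omega>\<bar> \<le> \<epsilon>\<close> in auto)
      finally show ?thesis using \<epsilon> False by simp
    qed
    have "char (distr M borel (X n)) t - char (distr M borel (Y n)) t =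
        (\<integral>\<omega>. iexp (t * X n \<omega>) - iexp (t * Y n \<omega>) \<partial>M)"
      unfolding char_def using int by (simp add: integral_distr)
    also have "norm \<dots> \<le> (\<integral>\<omega>. norm (iexp (t * X n \<omega>) - iexp (t * Y n \<omega>)) \<partial>M)"
      by (rule integral_norm_bound)
    also have "\<dots> \<le> (\<integral>\<omega>. e / 2 + 2 * indicator (A n) \<omega> \<partial>M)"
      using int pw by (intro integral_mono) (auto simp: emeasure_eq_measure)
    also have "\<dots> = e / 2 + 2 * prob (A n)"
      by (simp add: prob_space emeasure_eq_measure)
    finally show ?thesis .
  qed
  have "(\<lambda>n. prob (A n)) \<longlonglongrightarrow> 0"
    using close \<epsilon>(1) unfolding little_o_p_def A_def by simp
  then have "\<forall>\<^sub>F n in sequentially. prob (A n) < e / 4"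
    using \<open>0 < e\<close> by (intro order_tendstoD) auto
  then show "\<forall>\<^sub>F n in sequentially.
      dist (char (distr M borel (X n)) t - char (distr M borel (Y n)) t) 0 < e"
  proof eventually_elim
    case (elim n)
    with bound[of n] show ?case by simp
  qed
qed


section \<open>Normal laws\<close>

text \<open>
  This description covers the point mass at 0 together with the proper normal laws, so no case
  distinction on the variance occurs from here on.
\<close>

lemma normal_law_eq_distr:
  assumes "0 \<le> v"
  shows "normal_law v = distr std_normal_distribution borel (\<lambda>z. sqrt v * z)"
proof (cases "v = 0")
  case True
  interpret real_distribution std_normal_distribution by (rule real_dist_normal_dist)
  show ?thesis using True by (simp add: normal_law_def)
next
  case False
  then have v: "0 < sqrt v" using assms by simp
  interpret S: prob_space std_normal_distribution
    using real_dist_normal_dist real_distribution_def by blast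
  have "distributed std_normal_distribution lborel (\<lambda>z. z) (normal_density 0 1)"
    by (auto simp: distributed_def distr_id2 cong: distr_cong)
  from S.normal_density_affine[OF this, of "sqrt v" 0] v
  have "distributed std_normal_distribution lborel (\<lambda>z. sqrt v * z) (normal_density 0 (sqrt v))"
    by simp
  then have "distr std_normal_distribution lborel (\<lambda>z. sqrt v * z) =
      density lborel (normal_density 0 (sqrt v))"
    by (simp add: distributed_def)
  moreover have "distr std_normal_distribution lborel (\<lambda>z. sqrt v * z) =
      distr std_normal_distribution borel (\<lambda>z. sqrt v * z)"
    by (rule distr_cong) auto
  ultimately show ?thesis using False by (simp add: normal_law_def)
qed

lemma real_distribution_normal_law: "0 \<le> v \<Longrightarrow> real_distribution (normal_law v)"
  unfolding normal_law_eq_distr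
  using real_dist_normal_dist
  by (intro prob_space.real_distribution_distr) (simp_all add: real_distribution_def)

lemma char_distr_scale:
  assumes "sets N = sets borel"
  shows "char (distr N borel (\<lambda>z. a * z)) t = char N (t * a)"
  unfolding char_def
  by (subst integral_distr) (simp_all add: measurable_cong_sets[OF assms refl] mult.assoc)

lemma char_normal_law:
  assumes "0 \<le> v"
  shows "char (normal_law v) t = complex_of_real (exp (- (t\<^sup>2 * v / 2)))"
  using assms
  by (simp add: normal_law_eq_distr char_distr_scale char_std_normal_distribution power_mult_distrib)

lemma quadratic_form_mult_transpose:
  fixes A :: "real^'n^'m"
  shows "b \<bullet> ((A ** transpose A) *v b) = (b v* A) \<bullet> (b v* A)"
  by (simp add: dot_lmul_matrix transpose_matrix_vector flip: matrix_vector_mul_assoc)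

lemma mv_normal_quadratic_form_nonneg:
  fixes V :: "real^'p^'p"
  assumes "mv_normal V N"
  shows "0 \<le> b \<bullet> (V *v b)"
proof -
  obtain A :: "real^'p^'p" where "V = A ** transpose A"
    using assms unfolding mv_normal_def by blast
  then show ?thesis by (simp add: quadratic_form_mult_transpose)
qed

lemma measurable_linear_image_PiM:
  "(\<lambda>z. A *v (\<chi> i. z i)) \<in>
     borel_measurable (\<Pi>\<^sub>M i\<in>(UNIV :: 'p::finite set). std_normal_distribution)"
proof -
  have "(\<lambda>z. (\<chi> i. z i) :: real^'p) \<in>
      borel_measurable (\<Pi>\<^sub>M i\<in>(UNIV :: 'p set). std_normal_distribution)"
    by (subst borel_measurable_euclidean_space) (auto simp: Basis_vec_def inner_axis)
  moreover have "(\<lambda>x. A *v x) \<in> borel_measurable borel"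
    by (intro borel_measurable_continuous_onI) (rule matrix_vector_mult_linear_continuous_on)
  ultimately show ?thesis
    by (rule measurable_compose)
qed

lemma prob_space_mv_normal:
  assumes "mv_normal V N"
  shows "prob_space N" "sets N = sets borel"
proof -
  have "prob_space (\<Pi>\<^sub>M i\<in>(UNIV :: 'a set). std_normal_distribution)"
    using real_dist_normal_dist by (intro prob_space_PiM) (simp add: real_distribution_def)
  then show "prob_space N" "sets N = sets borel"
    using assms measurable_linear_image_PiM
    by (auto simp: mv_normal_def intro: prob_space.prob_space_distr)
qed

text \<open>
  Writing \<open>V\<close> as \<open>A ** transpose A\<close>, the projection is the linear combination of independent
  standard normals with coefficient vector \<open>b v* A\<close>, whose squared length is the quadratic form
  of \<open>V\<close> at \<open>b\<close>.
\<close>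

lemma char_mv_normal_inner:
  fixes V :: "real^'p^'p"
  assumes N: "mv_normal V N"
  shows "char (distr N borel ((\<bullet>) b)) t = char (normal_law (b \<bullet> (V *v b))) t"
proof -
  let ?P = "\<Pi>\<^sub>M i\<in>(UNIV :: 'p set). std_normal_distribution"
  obtain A :: "real^'p^'p" where V: "V = A ** transpose A" and N_eq: "N = distr ?P borel (\<lambda>z. A *v (\<chi> i. z i))"
    using N unfolding mv_normal_def by blast
  define a where "a = b v* A"
  have V_eq: "b \<bullet> (V *v b) = (\<Sum>i\<in>UNIV. (a $ i)\<^sup>2)"
    unfolding V a_def quadratic_form_mult_transpose by (simp add: inner_vec_def power2_eq_square)
  have proj: "b \<bullet> (A *v (\<chi> i. z i)) = (\<Sum>i\<in>UNIV. a $ i * z i)" for z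
  proof -
    have "b \<bullet> (A *v (\<chi> i. z i)) = a \<bullet> (\<chi> i. z i)"
      unfolding a_def by (rule dot_lmul_matrix[symmetric])
    then show ?thesis by (simp add: inner_vec_def)
  qed
  interpret S: real_distribution std_normal_distribution by (rule real_dist_normal_dist)
  interpret product_sigma_finite "\<lambda>_::'p. std_normal_distribution"
    by unfold_locales
  have "char (distr N borel ((\<bullet>) b)) t = (\<integral>z. iexp (t * (b \<bullet> (A *v (\<chi> i. z i)))) \<partial>?P)"
    unfolding char_def N_eq
    by (subst integral_distr, simp, simp, subst integral_distr) (auto simp: measurable_linear_image_PiM)
  also have "\<dots> = (\<integral>z. (\<Prod>i\<in>UNIV. iexp (t * a $ i * z i)) \<partial>?P)"
    by (simp add: proj sum_distrib_left mult.assoc flip: exp_sum)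
  also have "\<dots> = (\<Prod>i\<in>UNIV. char std_normal_distribution (t * a $ i))"
    unfolding char_def
    by (rule product_integral_prod) (auto intro!: S.integrable_iexp)
  also have "\<dots> = complex_of_real (exp (\<Sum>i\<in>UNIV. - ((t * a $ i)\<^sup>2) / 2))"
    by (simp add: char_std_normal_distribution exp_sum)
  also have "(\<Sum>i\<in>UNIV. - ((t * a $ i)\<^sup>2) / 2) = - (t\<^sup>2 * (b \<bullet> (V *v b)) / 2)"
    by (simp add: V_eq power_mult_distrib sum_negf sum_distrib_left sum_divide_distrib)
  finally show ?thesis
    by (simp add: char_normal_law mv_normal_quadratic_form_nonneg[OF N])
qed


section \<open>The delta method\<close>

lemma little_o_p_add:
  assumes M: "prob_space M"
    and Y: "\<And>n. 1 \<le> n \<Longrightarrow> Y n \<in> borel_measurable M" and Z: "\<And>n. 1 \<le> n \<Longrightarrow> Z n \<in> borel_measurable M"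
    and "little_o_p M Y r" "little_o_p M Z r"
  shows "little_o_p M (\<lambda>n \<omega>. Y n \<omega> + Z n \<omega>) r"
  unfolding little_o_p_def
proof (intro allI impI)
  fix \<epsilon> :: real assume "0 < \<epsilon>"
  interpret prob_space M by fact
  let ?A = "\<lambda>W n. {\<omega> \<in> space M. \<bar>W n \<omega>\<bar> > \<epsilon> / 2 * r n}"
  have lim: "(\<lambda>n. prob (?A Y n) + prob (?A Z n)) \<longlonglongrightarrow> 0 + 0"
    using assms(4,5) half_gt_zero[OF \<open>0 < \<epsilon>\<close>] unfolding little_o_p_def
    by (intro tendsto_add) blast+
  have "prob {\<omega> \<in> space M. \<bar>Y n \<omega> + Z n \<omega>\<bar> > \<epsilon> * r n} \<le> prob (?A Y n) + prob (?A Z n)"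
    if "1 \<le> n" for n
  proof -
    note [measurable] = Y[OF that] Z[OF that]
    have "prob {\<omega> \<in> space M. \<bar>Y n \<omega> + Z n \<omega>\<bar> > \<epsilon> * r n} \<le> prob (?A Y n \<union> ?A Z n)"
    proof (rule finite_measure_mono)
      have "\<epsilon> * r n = \<epsilon> / 2 * r n + \<epsilon> / 2 * r n" by simp
      then show "{\<omega> \<in> space M. \<bar>Y n \<omega> + Z n \<omega>\<bar> > \<epsilon> * r n} \<subseteq> ?A Y n \<union> ?A Z n"
        by (smt (verit) Un_iff mem_Collect_eq subsetI)
    qed measurable
    also have "\<dots> \<le> prob (?A Y n) + prob (?A Z n)"
      by (intro measure_Un_le) measurable
    finally show ?thesis .
  qed
  then have "\<forall>\<^sub>F n in sequentially.
      prob {\<omega> \<in> space M. \<bar>Y n \<omega> + Z n \<omega>\<bar> > \<epsilon> * r n} \<le> prob (?A Y n) + prob (?A Z n)"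
    unfolding eventually_sequentially by blast
  then show "(\<lambda>n. prob {\<omega> \<in> space M. \<bar>Y n \<omega> + Z n \<omega>\<bar> > \<epsilon> * r n}) \<longlonglongrightarrow> 0"
    by (rule tendsto_sandwich[OF _ _ tendsto_const lim[unfolded add_0_right], rotated]) simp
qed

text \<open>
  By tightness, \<open>T n\<close> lies within distance \<open>K / sqrt n\<close> of \<open>\<theta>\<close> with probability close to 1, and there
  the linearisation error is at most an arbitrarily small multiple of \<open>K / sqrt n\<close>.
\<close>

lemma linearisation_error_little_o_p:
  fixes T :: "nat \<Rightarrow> 'w \<Rightarrow> 'a::euclidean_space" and g :: "'a \<Rightarrow> real"
  assumes M: "prob_space M"
    and conv: "conv_in_distr (\<lambda>n. distr M borel (\<lambda>\<omega>. sqrt (real n) *\<^sub>R (T n \<omega> - \<theta>))) N"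
    and N: "prob_space N" "sets N = sets borel"
    and T: "\<And>n. 1 \<le> n \<Longrightarrow> T n \<in> borel_measurable M"
      "\<And>n \<omega>. 1 \<le> n \<Longrightarrow> \<omega> \<in> space M \<Longrightarrow> T n \<omega> \<in> \<Theta>"
    and g: "(g has_derivative L) (at \<theta> within \<Theta>)"
  shows "little_o_p M (\<lambda>n \<omega>. g (T n \<omega>) - g \<theta> - L (T n \<omega> - \<theta>)) (\<lambda>n. 1 / sqrt (real n))"
  unfolding little_o_p_def
proof (intro allI impI)
  fix \<epsilon> :: real assume "0 < \<epsilon>"
  interpret prob_space M by fact
  define S where "S n \<omega> = sqrt (real n) *\<^sub>R (T n \<omega> - \<theta>)" for n \<omega>
  have S [measurable]: "S n \<in> borel_measurable M" for n
  proof (cases "n = 0")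
    case False
    then have [measurable]: "T n \<in> borel_measurable M" using T(1) by simp
    show ?thesis unfolding S_def by measurable
  qed (simp add: S_def[abs_def])
  let ?B = "\<lambda>n. {\<omega> \<in> space M. \<bar>g (T n \<omega>) - g \<theta> - L (T n \<omega> - \<theta>)\<bar> > \<epsilon> * (1 / sqrt (real n))}"
  show "(\<lambda>n. prob (?B n)) \<longlonglongrightarrow> 0"
  proof (rule tendstoI)
    fix e :: real assume "0 < e"
    have "conv_in_distr (\<lambda>n. distr M borel (S n)) N"
      using conv by (simp add: S_def[abs_def])
    from conv_in_distr_tight[OF this N prob_space_distr[OF S] sets_distr \<open>0 < e\<close>]
    obtain K where K: "0 < K" "\<forall>\<^sub>F n in sequentially. measure (distr M borel (S n)) {x. K < norm x} < e"
      by blast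
    have "0 < \<epsilon> / K" using \<open>0 < \<epsilon>\<close> K by simp
    then obtain \<delta> where \<delta>: "0 < \<delta>"
        "\<And>x. x \<in> \<Theta> \<Longrightarrow> norm (x - \<theta>) < \<delta> \<Longrightarrow> norm (g x - g \<theta> - L (x - \<theta>)) \<le> \<epsilon> / K * norm (x - \<theta>)"
      using g unfolding has_derivative_within_alt by metis
    have "\<forall>\<^sub>F n in sequentially. K / \<delta> < sqrt (real n)"
      by (rule filterlim_compose[OF sqrt_at_top filterlim_real_sequentially,
            THEN filterlim_at_top_dense[THEN iffD1], rule_format])
    with K(2) eventually_ge_at_top[of 1] show "\<forall>\<^sub>F n in sequentially. dist (prob (?B n)) 0 < e"
    proof eventually_elim
      case (elim n)
      have n: "0 < sqrt (real n)" using elim by simp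
      have "prob (?B n) \<le> prob (S n -` {x. K < norm x} \<inter> space M)"
      proof (rule finite_measure_mono)
        show "?B n \<subseteq> S n -` {x. K < norm x} \<inter> space M"
        proof (rule ccontr)
          assume "\<not> ?thesis"
          then obtain \<omega> where \<omega>: "\<omega> \<in> ?B n" "norm (S n \<omega>) \<le> K" by force
          have le: "norm (T n \<omega> - \<theta>) \<le> K / sqrt (real n)"
            using \<omega>(2) n by (simp add: S_def pos_le_divide_eq mult.commute)
          also have "\<dots> < \<delta>" using elim \<delta>(1) n by (simp add: field_simps)
          finally have "norm (T n \<omega> - \<theta>) < \<delta>" .
          then have "\<bar>g (T n \<omega>) - g \<theta> - L (T n \<omega> - \<theta>)\<bar> \<le> \<epsilon> / K * norm (T n \<omega> - \<theta>)"
            using \<delta>(2) T(2) elim \<omega>(1) by auto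
          also have "\<dots> \<le> \<epsilon> / K * (K / sqrt (real n))"
            using \<open>0 < \<epsilon> / K\<close> le by (intro mult_left_mono) auto
          finally show False using \<omega>(1) K(1) by simp
        qed
      qed measurable
      also have "\<dots> < e"
        using elim by (simp add: measure_distr)
      finally show ?case by simp
    qed
  qed
qed

text \<open>
  At \<open>n = 0\<close> both rates are degenerate; the equivalence only sees the positive \<open>n\<close>.
\<close>

lemma little_o_p_inverse_sqrt_iff:
  "little_o_p M Y (\<lambda>n. 1 / sqrt (real n)) \<longleftrightarrow> little_o_p M (\<lambda>n \<omega>. sqrt (real n) * Y n \<omega>) (\<lambda>_. 1)"
proof -
  have "\<forall>\<^sub>F n in sequentially. measure M {\<omega> \<in> space M. \<bar>Y n \<omega>\<bar> > \<epsilon> * (1 / sqrt (real n))} =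
      measure M {\<omega> \<in> space M. \<bar>sqrt (real n) * Y n \<omega>\<bar> > \<epsilon> * 1}" for \<epsilon>
    using eventually_gt_at_top[of 0]
    by eventually_elim (simp add: abs_mult field_simps)
  from tendsto_cong[OF this] show ?thesis
    unfolding little_o_p_def by (simp only:)
qed

text \<open>
  The statistic \<open>W n\<close> is an approximation of \<open>g (T n)\<close> with an error that disappears at the scale
  \<open>1 / sqrt n\<close>.  Where \<open>\<Theta>\<close> is thin at \<open>\<theta>\<close>, several vectors \<open>b\<close> can represent a derivative of
  \<open>g\<close> within \<open>\<Theta>\<close>.  Each of them controls the linearisation error on \<open>\<Theta>\<close>, which contains all
  values of \<open>T n\<close>, so they all lead to the same limit law.
\<close>

theorem delta_method:
  fixes T :: "nat \<Rightarrow> 'w \<Rightarrow> real^'p" and g :: "real^'p \<Rightarrow> real"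
  assumes M: "prob_space M"
    and est: "asymp_normal_est M T \<theta> V"
    and T: "\<And>n. 1 \<le> n \<Longrightarrow> T n \<in> borel_measurable M"
      "\<And>n \<omega>. 1 \<le> n \<Longrightarrow> \<omega> \<in> space M \<Longrightarrow> T n \<omega> \<in> \<Theta>"
    and g: "continuous_on \<Theta> g" "(g has_derivative (\<bullet>) b) (at \<theta> within \<Theta>)"
    and W: "\<And>n. 1 \<le> n \<Longrightarrow> W n \<in> borel_measurable M"
      "little_o_p M (\<lambda>n \<omega>. W n \<omega> - g (T n \<omega>)) (\<lambda>n. 1 / sqrt (real n))"
  shows "weak_conv_m (\<lambda>n. distr M borel (\<lambda>\<omega>. sqrt (real n) * (W n \<omega> - g \<theta>)))
           (normal_law (b \<bullet> (V *v b)))"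
proof -
  interpret prob_space M by fact
  obtain N where N: "mv_normal V N"
    and conv: "conv_in_distr (\<lambda>n. distr M borel (\<lambda>\<omega>. sqrt (real n) *\<^sub>R (T n \<omega> - \<theta>))) N"
    using est by (auto simp: asymp_normal_est_def)
  define S where "S n \<omega> = sqrt (real n) *\<^sub>R (T n \<omega> - \<theta>)" for n \<omega>
  define Y where "Y n \<omega> = sqrt (real n) * (W n \<omega> - g \<theta>)" for n \<omega>
  \<comment> \<open>At \<open>n = 0\<close>, where nothing is known about \<open>T\<close> and \<open>W\<close>, the factor \<open>sqrt n\<close> vanishes.\<close>
  have S [measurable]: "S n \<in> borel_measurable M" and Y [measurable]: "Y n \<in> borel_measurable M" for n
  proof -
    have "S n \<in> borel_measurable M \<and> Y n \<in> borel_measurable M"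
    proof (cases "n = 0")
      case False
      then have [measurable]: "T n \<in> borel_measurable M" "W n \<in> borel_measurable M"
        using T(1) W(1) by simp_all
      show ?thesis unfolding S_def Y_def by measurable
    qed (simp add: S_def[abs_def] Y_def[abs_def])
    then show "S n \<in> borel_measurable M" "Y n \<in> borel_measurable M" by auto
  qed
  \<comment> \<open>Outside \<open>\<Theta>\<close> the function \<open>g\<close> is arbitrary, so it is composed as a map on the subspace \<open>\<Theta>\<close>.\<close>
  have gT: "(\<lambda>\<omega>. g (T n \<omega>)) \<in> borel_measurable M" if "1 \<le> n" for n
  proof (rule measurable_compose[where g = g])
    show "T n \<in> measurable M (restrict_space borel \<Theta>)"
      using T that by (auto simp: measurable_restrict_space2_iff)
    show "g \<in> borel_measurable (restrict_space borel \<Theta>)"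
      using g(1) by (rule borel_measurable_continuous_on_restrict)
  qed
  have "little_o_p M (\<lambda>n \<omega>. (W n \<omega> - g (T n \<omega>)) + (g (T n \<omega>) - g \<theta> - b \<bullet> (T n \<omega> - \<theta>)))
      (\<lambda>n. 1 / sqrt (real n))"
  proof (rule little_o_p_add[OF M])
    show "little_o_p M (\<lambda>n \<omega>. g (T n \<omega>) - g \<theta> - b \<bullet> (T n \<omega> - \<theta>)) (\<lambda>n. 1 / sqrt (real n))"
      using M conv prob_space_mv_normal[OF N] T g(2) by (rule linearisation_error_little_o_p)
  qed (use gT T W in \<open>auto intro!: borel_measurable_diff borel_measurable_inner\<close>)
  then have "little_o_p M (\<lambda>n \<omega>. Y n \<omega> - b \<bullet> S n \<omega>) (\<lambda>_. 1)"
    unfolding little_o_p_inverse_sqrt_iff by (simp add: Y_def S_def algebra_simps)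
  then have diff: "(\<lambda>n. char (distr M borel (Y n)) t - char (distr M borel (\<lambda>\<omega>. b \<bullet> S n \<omega>)) t) \<longlonglongrightarrow> 0" for t
    by (intro char_distr_diff_tendsto_0 M) measurable
  have lin: "(\<lambda>n. char (distr M borel (\<lambda>\<omega>. b \<bullet> S n \<omega>)) t) \<longlonglongrightarrow> char (normal_law (b \<bullet> (V *v b))) t" for t
  proof -
    have "(\<lambda>n. char (distr (distr M borel (S n)) borel ((\<bullet>) b)) t) \<longlonglongrightarrow> char (distr N borel ((\<bullet>) b)) t"
      using conv prob_space_mv_normal[OF N]
      by (intro conv_in_distr_imp_char_inner) (auto simp: S_def[symmetric] intro: prob_space_distr)
    then show ?thesis
      by (simp add: distr_distr comp_def char_mv_normal_inner[OF N])
  qed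
  have "weak_conv_m (\<lambda>n. distr M borel (Y n)) (normal_law (b \<bullet> (V *v b)))"
  proof (rule levy_continuity)
    show "(\<lambda>n. char (distr M borel (Y n)) t) \<longlonglongrightarrow> char (normal_law (b \<bullet> (V *v b))) t" for t
      using tendsto_add[OF diff[of t] lin[of t]] by simp
  qed (auto intro: real_distribution_normal_law mv_normal_quadratic_form_nonneg[OF N])
  then show ?thesis by (simp add: Y_def[abs_def])
qed

lemma linear_functional_eq_inner:
  fixes L :: "real^'p \<Rightarrow> real"
  assumes "linear L"
  shows "L = (\<bullet>) (\<chi> i. L (axis i 1))"
proof
  fix h
  have "L h = L (\<Sum>i\<in>UNIV. h $ i *s axis i 1)"
    by (simp add: basis_expansion)
  also have "\<dots> = (\<Sum>i\<in>UNIV. h $ i * L (axis i 1))"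
    by (simp add: linear_sum[OF assms] linear_scale[OF assms] scalar_mult_eq_scaleR)
  finally show "L h = (\<chi> i. L (axis i 1)) \<bullet> h"
    by (simp add: inner_vec_def mult.commute)
qed


section \<open>Phi-dependence\<close>

theorem theorem2:
  fixes k :: nat and d :: "nat \<Rightarrow> nat"
    and M :: "'w measure"
    and \<Theta> :: "(real^'p) set" and \<theta>\<^sub>C :: "real^'p" and V :: "real^'p^'p"
    and \<Phi> :: "real \<Rightarrow> real"
    and c :: "(nat \<times> nat \<Rightarrow> real) \<Rightarrow> real^'p \<Rightarrow> real"
    and cm :: "nat \<Rightarrow> (nat \<Rightarrow> real) \<Rightarrow> real^'p \<Rightarrow> real"
    and H :: "(nat \<times> nat \<Rightarrow> real) measure"
    and X :: "nat \<Rightarrow> 'w \<Rightarrow> nat \<times> nat \<Rightarrow> real"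
    and \<theta>hat :: "nat \<Rightarrow> 'w \<Rightarrow> real^'p"
    and m :: "nat \<Rightarrow> nat"
    and U :: "nat \<Rightarrow> nat \<Rightarrow> 'w \<Rightarrow> nat \<times> nat \<Rightarrow> real"
  defines "I \<equiv> block_idx k d"
  defines "f \<equiv> phi_integrand k d \<Phi> c cm"
  defines "\<D> \<equiv> phi_dependence k d \<Phi> c cm"
  defines "Dhat \<equiv> (\<lambda>n \<omega>. phi_estimator k d \<Phi> c cm (m n) (\<lambda>l. U n l \<omega>) (\<theta>hat n \<omega>))"
  defines "\<beta> \<equiv> (\<chi> i. \<integral>u. partial_deriv \<Theta> (f u) \<theta>\<^sub>C i \<partial>unit_cube I)"
  assumes "1 \<le> k" and "\<And>i. i \<in> {1..k} \<Longrightarrow> 1 \<le> d i"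
    and "continuous_on {0<..} \<Phi>" and "convex_on {0<..} \<Phi>" and "\<Phi> 1 = 0"
    and "\<theta>\<^sub>C \<in> \<Theta>"
    and "\<And>\<theta>. \<theta> \<in> \<Theta> \<Longrightarrow> copula_density I (\<lambda>u. c u \<theta>)"
    and "\<And>\<theta> i. \<theta> \<in> \<Theta> \<Longrightarrow> i \<in> {1..k} \<Longrightarrow>
           block_marginal_density k d (\<lambda>u. c u \<theta>) i (\<lambda>v. cm i v \<theta>)"
    and "prob_space M"
    and "sets H = sets (\<Pi>\<^sub>M j\<in>I. (borel :: real measure))"
    and "\<And>j. j \<in> I \<Longrightarrow> continuous_on UNIV (cdf (distr H borel (\<lambda>x. x j)))"
    and "has_copula I H (copula_of I (\<lambda>u. c u \<theta>\<^sub>C))"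
    and "iid_sample M H X {1..}"
    and "\<And>n. 1 \<le> n \<Longrightarrow> \<exists>T \<in> borel_measurable (\<Pi>\<^sub>M l\<in>{1..n}. H).
           \<forall>\<omega>\<in>space M. \<theta>hat n \<omega> = T (\<lambda>l\<in>{1..n}. X l \<omega>)"
    and "\<And>n \<omega>. 1 \<le> n \<Longrightarrow> \<omega> \<in> space M \<Longrightarrow> \<theta>hat n \<omega> \<in> \<Theta>"
    and "asymp_normal_est M \<theta>hat \<theta>\<^sub>C V"
    and "\<And>n. 1 \<le> n \<Longrightarrow> 1 \<le> m n"
    and "\<And>n. 1 \<le> n \<Longrightarrow>
           cond_iid_sample M (\<theta>hat n) (unit_cube I) (\<lambda>\<theta>. copula_of I (\<lambda>u. c u \<theta>)) (m n) (U n)"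
    and "\<And>n. 1 \<le> n \<Longrightarrow> Dhat n \<in> borel_measurable M"
    and "little_o_p M (\<lambda>n \<omega>. Dhat n \<omega> - \<D> (\<theta>hat n \<omega>)) (\<lambda>n. 1 / sqrt (real n))"
    and "\<And>\<theta>. \<theta> \<in> \<Theta> \<Longrightarrow> integrable (unit_cube I) (\<lambda>u. f u \<theta>)"
    and "\<D> differentiable_on \<Theta>"
  shows "(\<exists>v\<ge>0. weak_conv_m (\<lambda>n. distr M borel (\<lambda>\<omega>. sqrt (real n) * (Dhat n \<omega> - \<D> \<theta>\<^sub>C)))
                            (normal_law v)) \<and>
         (deriv_into_integral \<Theta> (unit_cube I) f \<theta>\<^sub>C \<longrightarrow>
            weak_conv_m (\<lambda>n. distr M borel (\<lambda>\<omega>. sqrt (real n) * (Dhat n \<omega> - \<D> \<theta>\<^sub>C)))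
                        (normal_law (\<beta> \<bullet> (V *v \<beta>))))"
proof -
  have meas: "\<theta>hat n \<in> borel_measurable M" if "1 \<le> n" for n
  proof -
    interpret prob_space M by fact
    obtain T where T: "T \<in> borel_measurable (\<Pi>\<^sub>M l\<in>{1..n}. H)"
        "\<And>\<omega>. \<omega> \<in> space M \<Longrightarrow> \<theta>hat n \<omega> = T (\<lambda>l\<in>{1..n}. X l \<omega>)"
      using assms(19)[OF \<open>1 \<le> n\<close>] by blast
    have "X l \<in> measurable M H" if "l \<in> {1..}" for l
      using \<open>iid_sample M H X {1..}\<close> that by (auto simp: iid_sample_def indep_vars_def)
    then have "(\<lambda>\<omega>. \<lambda>l\<in>{1..n}. X l \<omega>) \<in> measurable M (\<Pi>\<^sub>M l\<in>{1..n}. H)"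
      by (intro measurable_restrict) auto
    from measurable_compose[OF this T(1)] show ?thesis
      using T(2) by (simp cong: measurable_cong)
  qed
  have diff: "\<D> differentiable (at \<theta>\<^sub>C within \<Theta>)" and cont: "continuous_on \<Theta> \<D>"
    using \<open>\<D> differentiable_on \<Theta>\<close> \<open>\<theta>\<^sub>C \<in> \<Theta>\<close>
    by (auto simp: differentiable_on_def intro: differentiable_imp_continuous_on)
  define L where "L = frechet_derivative \<D> (at \<theta>\<^sub>C within \<Theta>)"
  define b where "b = (\<chi> i. L (axis i 1))"
  have L: "(\<D> has_derivative L) (at \<theta>\<^sub>C within \<Theta>)"
    using diff unfolding L_def by (rule frechet_derivative_works[THEN iffD1])
  then have L_eq: "L = (\<bullet>) b"
    unfolding b_def by (intro linear_functional_eq_inner has_derivative_linear)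
  have lim: "weak_conv_m (\<lambda>n. distr M borel (\<lambda>\<omega>. sqrt (real n) * (Dhat n \<omega> - \<D> \<theta>\<^sub>C)))
      (normal_law (b \<bullet> (V *v b)))"
    by (rule delta_method[where T = \<theta>hat and \<Theta> = \<Theta>]) (use assms meas cont L L_eq in auto)
  have "0 \<le> b \<bullet> (V *v b)"
    using \<open>asymp_normal_est M \<theta>hat \<theta>\<^sub>C V\<close>
    by (auto simp: asymp_normal_est_def intro: mv_normal_quadratic_form_nonneg)
  moreover have "b = \<beta>" if into: "deriv_into_integral \<Theta> (unit_cube I) f \<theta>\<^sub>C"
  proof -
    let ?p = "\<lambda>i u. partial_deriv \<Theta> (f u) \<theta>\<^sub>C i"
    have "\<D> = (\<lambda>\<eta>. \<integral>u. f u \<eta> \<partial>unit_cube I)"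
      by (simp add: fun_eq_iff \<D>_def f_def I_def phi_dependence_def)
    then have "L h = (\<integral>u. (\<Sum>i\<in>UNIV. h $ i * ?p i u) \<partial>unit_cube I)" for h
      using into by (simp add: L_def deriv_into_integral_def)
    \<comment> \<open>In the direction \<open>axis j 1\<close> only the \<open>j\<close>-th summand survives.\<close>
    then have "L (axis j 1) = (\<integral>u. ?p j u \<partial>unit_cube I)" for j
      by (simp add: axis_def if_distrib[of "\<lambda>x. x * _"] cong: if_cong)
    then show ?thesis
      by (simp add: b_def \<beta>_def)
  qed
  ultimately show ?thesis
    using lim by auto
qed

end
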